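(* Let $\ell\ge 1$, $q\in\mathbb{C}^*$ with $|q|<1$, let $\lambda_1,\ldots,\lambda_{\ell+1}\in\mathbb{C}$ and $z_i=e^{\lambda_i}$, $\underline z=(z_1,\ldots,z_{\ell+1})$. Then for all integers $n\ge 0$ and $k\in\mathbb{Z}$, $$\Psi^{\mathfrak{gl}_{\ell+1}}_{\underline z}(n,k)\,=\,\chi_{n,k}(\underline z),$$ where $$\chi_{n,k}(\underline z)\,=\,\lim_{d\to\infty}A^{(d)}_{n,k}(\underline z,q)\,=\,\mathrm{Tr}_{\mathcal{V}_{n,k,\infty}}\,q^{L_0}e^{\sum_{i=1}^{\ell+1}\lambda_iH_i}.$$ Here $\Psi^{\mathfrak{gl}_{\ell+1}}_{\underline z}(n,k)$ is the specialized class one $q$-deformed $\mathfrak{gl}_{\ell+1}$-Whittaker function, $A^{(d)}_{n,k}$ is the character of the space of holomorphic sections $\mathcal{V}_{n,k,d}=H^0(\mathcal{QM}_d(\mathbb{P}^\ell),\mathcal{L}_k(n))$, and $\mathcal{V}_{n,k,\infty}$ is the $\mathbb{C}^*\times GL_{\ell+1}(\mathbb{C})$-module of degree $n$ polynomials in infinitely many variables, all as defined in the context.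
   Context: Notation: $(m)_q!=\prod_{j=1}^m(1-q^j)$ for $m\ge 0$ (so $(0)_q!=1$). Whittaker function. For $\underline p=(p_1,\ldots,p_{\ell+1})\in\mathbb{Z}^{\ell+1}$ with $p_1\ge\cdots\ge p_{\ell+1}$, put $p_{\ell+1,i}=p_i$ and define $$\Psi^{\mathfrak{gl}_{\ell+1}}_{\underline z}(\underline p)=\sum\ \prod_{r=1}^{\ell+1}z_r^{\sum_{i=1}^{r}p_{r,i}-\sum_{i=1}^{r-1}p_{r-1,i}}\ \frac{\prod_{r=2}^{\ell}\prod_{i=1}^{r-1}(p_{r,i}-p_{r,i+1})_q!}{\prod_{r=1}^{\ell}\prod_{i=1}^{r}(p_{r+1,i}-p_{r,i})_q!\,(p_{r,i}-p_{r+1,i+1})_q!},$$ the sum being over all integer arrays $(p_{r,i})_{1\le i\le r\le \ell}$ satisfying the Gelfand-Zetlin conditions $p_{r+1,i}\ge p_{r,i}\ge p_{r+1,i+1}$ for $1\le i\le r\le\ell$. Put $\Psi^{\mathfrak{gl}_{\ell+1}}_{\underline z}(\underline p)=0$ if $p_1\ge\cdots\ge p_{\ell+1}$ fails. The specialized function is $\Psi^{\mathfrak{gl}_{\ell+1}}_{\underline z}(n,k):=\Psi^{\mathfrak{gl}_{\ell+1}}_{\underline z}(n+k,k,\ldots,k)$. Quasi-maps. $\mathcal{QM}_d(\mathbb{P}^\ell)$ is the space of nonzero $(\ell+1)$-tuples $(a_0(y):\cdots:a_\ell(y))$ of homogeneous polynomials of degree $d$ in $y=(y_1,y_2)$, $a_r(y)=\sum_{j=0}^d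 a_{r,j}y_1^jy_2^{d-j}$, considered up to a common nonzero constant; thus $\mathcal{QM}_d(\mathbb{P}^\ell)\cong\mathbb{P}^{(\ell+1)(d+1)-1}$ with homogeneous coordinates $a_{r,j}$. The group $\mathbb{C}^*\times GL_{\ell+1}(\mathbb{C})$ acts, $\mathbb{C}^*$ by $(y_1,y_2)\mapsto(\xi y_1,y_2)$ and $GL_{\ell+1}$ by linear transformations of the tuple $(a_0,\ldots,a_\ell)$. $L_0$ is the generator of $\mathrm{Lie}(\mathbb{C}^* )$, and $H_1,\ldots,H_{\ell+1}$ is the standard basis of the Lie algebra of the diagonal torus of $GL_{\ell+1}$. Their action on coordinates is $q^{L_0}:a_{r,j}\mapsto q^ja_{r,j}$ and $e^{\sum\lambda_iH_i}:a_{r,j}\mapsto e^{\lambda_{r+1}}a_{r,j}$. $\mathcal{L}_k$ is the one-dimensional $GL_{\ell+1}$-module on which each $H_i$ acts by $k$ (so $e^{\sum\lambda_iH_i}$ acts by $\prod_iz_i^k$), and $\mathcal{L}_k(n)=\mathcal{O}(n)\otimes\mathcal{L}_k$. For $n\ge0$, $\mathcal{V}_{n,k,d}=H^0(\mathcal{QM}_d(\mathbb{P}^\ell),\mathcal{L}_k(n))$ is identified with the space of degree $n$ homogeneous polynomials in the $(\ell+1)(d+1)$ variables $a_{r,j}$, with the action $q^{L_0}:a_{r,j}\mapsto q^ja_{r,j}$, $e^{\sum\lambda_iH_i}:a_{r,j}\mapsto e^{\lambda_{r+1}}a_{r,j}$ on the variables extended multiplicatively to polynomials and twisted by $\mathcal{L}_k$.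 Its character is $A^{(d)}_{n,k}(\underline z,q)=\mathrm{Tr}_{\mathcal{V}_{n,k,d}}q^{L_0}e^{\sum\lambda_iH_i}$. Infinite-dimensional module. $\mathcal{V}_{k,\infty}$ is the space of polynomials in infinitely many variables $a_{r,m}$, $0\le r\le\ell$, $m\in\mathbb{Z}_{\ge0}$, with $q^{L_0}:a_{r,m}\mapsto q^ma_{r,m}$ (i.e. $L_0a_{r,m}=m\,a_{r,m}$) and $e^{\sum\lambda_iH_i}:a_{r,m}\mapsto e^{\lambda_{r+1}}a_{r,m}$, extended multiplicatively to polynomials and twisted by $\mathcal{L}_k$. $\mathcal{V}_{n,k,\infty}\subset\mathcal{V}_{k,\infty}$ is the subspace of polynomials homogeneous of total degree $n$. *)

theory Defs
  imports "HOL-Analysis.Analysis" "HOL-Library.Poly_Mapping"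
begin

section \<open>The q-deformed Whittaker function\<close>

definition qfact :: "complex \<Rightarrow> nat \<Rightarrow> complex" where
  "qfact q m = (\<Prod>j=1..m. 1 - q ^ j)"

text \<open>An array \<open>P\<close> has entries \<open>P r i\<close> for \<open>1 \<le> i \<le> r \<le> l + 1\<close>; its top row
  \<open>P (l + 1)\<close> is prescribed to be \<open>p\<close>. The entries outside the triangle are set to \<open>0\<close>, so that
  an array is determined by its triangle and the set below is finite.\<close>

definition GZ_arrays :: "nat \<Rightarrow> (nat \<Rightarrow> int) \<Rightarrow> (nat \<Rightarrow> nat \<Rightarrow> int) set" where
  "GZ_arrays l p = {P.
     (\<forall>i\<in>{1..l+1}. P (l + 1) i = p i) \<and>
     (\<forall>r\<in>{1..l}. \<forall>i\<in>{1..r}. P r i \<le> P (r + 1) i \<and> P (r + 1) (i + 1) \<le> P r i) \<and>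
     (\<forall>r i. \<not> (1 \<le> i \<and> i \<le> r \<and> r \<le> l + 1) \<longrightarrow> P r i = 0)}"

text \<open>In every use of \<open>nat\<close> below the argument is nonnegative by the Gelfand-Zetlin conditions.\<close>

definition GZ_weight :: "nat \<Rightarrow> complex \<Rightarrow> (nat \<Rightarrow> complex) \<Rightarrow> (nat \<Rightarrow> nat \<Rightarrow> int) \<Rightarrow> complex" where
  "GZ_weight l q z P =
     (\<Prod>r=1..l+1. z r powi ((\<Sum>i=1..r. P r i) - (\<Sum>i=1..r-1. P (r - 1) i))) *
     ((\<Prod>r=2..l. \<Prod>i=1..r-1. qfact q (nat (P r i - P r (i + 1)))) /
      (\<Prod>r=1..l. \<Prod>i=1..r. qfact q (nat (P (r + 1) i - P r i)) *
                             qfact q (nat (P r i - P (r + 1) (i + 1)))))"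

definition whittaker :: "nat \<Rightarrow> complex \<Rightarrow> (nat \<Rightarrow> complex) \<Rightarrow> (nat \<Rightarrow> int) \<Rightarrow> complex" where
  "whittaker l q z p =
     (if \<forall>i\<in>{1..l}. p (i + 1) \<le> p i then \<Sum>P\<in>GZ_arrays l p. GZ_weight l q z P else 0)"

definition whittaker_spec :: "nat \<Rightarrow> complex \<Rightarrow> (nat \<Rightarrow> complex) \<Rightarrow> int \<Rightarrow> int \<Rightarrow> complex" where
  "whittaker_spec l q z n k = whittaker l q z (\<lambda>i. if i = 1 then n + k else k)"


section \<open>Polynomials in arbitrarily many variables\<close>

text \<open>A monomial is its finitely supported exponent function, a polynomial the finitely supported
  function of its coefficients; the product is that of the library's instance for
  \<^type>\<open>poly_mapping\<close>.\<close>

type_synonym 'v cpoly = "('v \<Rightarrow>\<^sub>0 nat) \<Rightarrow>\<^sub>0 complex"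

definition cscale :: "complex \<Rightarrow> 'v cpoly \<Rightarrow> 'v cpoly" where
  "cscale c f = Poly_Mapping.single 0 c * f"

interpretation cpoly: vector_space "cscale :: complex \<Rightarrow> 'v cpoly \<Rightarrow> 'v cpoly"
  by standard
    (simp_all add: cscale_def algebra_simps single_add mult_single flip: mult.assoc)

definition Var :: "'v \<Rightarrow> 'v cpoly" where
  "Var v = Poly_Mapping.single (Poly_Mapping.single v 1) 1"

definition mon_degree :: "('v \<Rightarrow>\<^sub>0 nat) \<Rightarrow> nat" where
  "mon_degree e = (\<Sum>v\<in>Poly_Mapping.keys e. Poly_Mapping.lookup e v)"

definition hom_polys :: "'v set \<Rightarrow> nat \<Rightarrow> 'v cpoly set" where
  "hom_polys X n = {f. \<forall>e\<in>Poly_Mapping.keys f. Poly_Mapping.keys e \<subseteq> X \<and> mon_degree e = n}"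

text \<open>The algebra endomorphism \<open>Var v \<mapsto> c v \<cdot> Var v\<close>.\<close>

definition dilate :: "('v \<Rightarrow> complex) \<Rightarrow> 'v cpoly \<Rightarrow> 'v cpoly" where
  "dilate c f =
     (\<Sum>e\<in>Poly_Mapping.keys f. cscale (Poly_Mapping.lookup f e)
        (\<Prod>v\<in>Poly_Mapping.keys e. cscale (c v) (Var v) ^ Poly_Mapping.lookup e v))"

lemma dilate_Var: "dilate c (Var v) = cscale (c v) (Var v)"
  by (simp add: dilate_def Var_def)

lemma cscale_Var_power:
  "cscale c (Var v) ^ m = Poly_Mapping.single (Poly_Mapping.single v m) (c ^ m)"
  by (induction m) (simp_all add: cscale_def Var_def mult_single flip: single_add)


section \<open>Traces\<close>

definition basis_of :: "'v cpoly set \<Rightarrow> 'v cpoly set \<Rightarrow> bool" where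
  "basis_of B V \<longleftrightarrow> cpoly.independent B \<and> cpoly.span B = V"

text \<open>The trace on a finite-dimensional invariant subspace \<open>V\<close>: the sum of the diagonal
  coefficients in a basis (of which the choice is immaterial).\<close>

definition fin_trace :: "'v cpoly set \<Rightarrow> ('v cpoly \<Rightarrow> 'v cpoly) \<Rightarrow> complex" where
  "fin_trace V T =
     (let B = (SOME B. basis_of B V) in \<Sum>b\<in>B. cpoly.representation B (T b) b)"

text \<open>The trace of a diagonalisable operator on a possibly infinite-dimensional subspace \<open>V\<close>:
  the sum of the diagonal coefficients in a basis of eigenvectors. The sum is required to converge
  unconditionally, to the same value for all such bases, of which there must be one.\<close>

definition eigenbasis_of ::
    "'v cpoly set \<Rightarrow> 'v cpoly set \<Rightarrow> ('v cpoly \<Rightarrow> 'v cpoly) \<Rightarrow> bool" where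
  "eigenbasis_of B V T \<longleftrightarrow> basis_of B V \<and> (\<forall>b\<in>B. \<exists>c. T b = cscale c b)"

definition has_trace :: "'v cpoly set \<Rightarrow> ('v cpoly \<Rightarrow> 'v cpoly) \<Rightarrow> complex \<Rightarrow> bool" where
  "has_trace V T t \<longleftrightarrow>
     (\<exists>B. eigenbasis_of B V T) \<and>
     (\<forall>B. eigenbasis_of B V T \<longrightarrow>
        ((\<lambda>b. cpoly.representation B (T b) b) has_sum t) B)"


section \<open>The modules and their characters\<close>

text \<open>The variable \<open>(r, j)\<close> stands for \<open>a\<^sub>r\<^sub>,\<^sub>j\<close>. \<open>H\<^sup>0\<close> of \<open>O(n)\<close> on the projective space of
  quasi-maps of degree \<open>d\<close> is the space of forms of degree \<open>n\<close> in its homogeneous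
  coordinates. The twist \<open>k\<close> enters the torus action only, not the underlying spaces.\<close>

definition V_fin :: "nat \<Rightarrow> nat \<Rightarrow> nat \<Rightarrow> (nat \<times> nat) cpoly set" where
  "V_fin l n d = hom_polys ({0..l} \<times> {0..d}) n"

definition V_inf :: "nat \<Rightarrow> nat \<Rightarrow> (nat \<times> nat) cpoly set" where
  "V_inf l n = hom_polys ({0..l} \<times> UNIV) n"

definition q_L0 :: "complex \<Rightarrow> (nat \<times> nat) cpoly \<Rightarrow> (nat \<times> nat) cpoly" where
  "q_L0 q = dilate (\<lambda>(r, j). q ^ j)"

text \<open>The operator \<open>exp (\<Sum>i. \<lambda>\<^sub>i H\<^sub>i)\<close>; the scalar factor is its action on the one-dimensional
  module on which each \<open>H\<^sub>i\<close> acts by \<open>k\<close>.\<close>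

definition exp_H ::
    "nat \<Rightarrow> int \<Rightarrow> (nat \<Rightarrow> complex) \<Rightarrow> (nat \<times> nat) cpoly \<Rightarrow> (nat \<times> nat) cpoly" where
  "exp_H l k lam f =
     cscale (\<Prod>i=1..l+1. exp (lam i) powi k) (dilate (\<lambda>(r, j). exp (lam (r + 1))) f)"

definition character ::
    "nat \<Rightarrow> complex \<Rightarrow> (nat \<Rightarrow> complex) \<Rightarrow> nat \<Rightarrow> int \<Rightarrow> nat \<Rightarrow> complex" where
  "character l q lam n k d = fin_trace (V_fin l n d) (q_L0 q \<circ> exp_H l k lam)"

definition chi :: "nat \<Rightarrow> complex \<Rightarrow> (nat \<Rightarrow> complex) \<Rightarrow> nat \<Rightarrow> int \<Rightarrow> complex" where
  "chi l q lam n k = lim (character l q lam n k)"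

end

theory Submission
  imports Defs
begin

text \<open>
  Both sides are coefficients of one power series in an auxiliary variable \<open>t\<close>. Up to the factor
  \<open>\<Prod>\<^sub>r z\<^sub>r\<^sup>k\<close>, which is the same on both sides, the group element acts on a monomial in the \<open>a\<^sub>r\<^sub>,\<^sub>j\<close> by the
  product of the values \<open>z\<^sub>r\<^sub>+\<^sub>1 q\<^sup>j\<close> of its variables. The trace on forms of degree \<open>n\<close> is thus the complete
  homogeneous sum of degree \<open>n\<close> in these values, the coefficient of \<open>t\<^sup>n\<close> in
  \<open>H(t) = \<Prod>\<^sub>r\<^sub>,\<^sub>j 1 / (1 - z\<^sub>r\<^sub>+\<^sub>1 q\<^sup>j t)\<close>. On the other side, a Gelfand-Zetlin array with top row
  \<open>(n + k, k, \<dots>, k)\<close> is a composition \<open>n = n\<^sub>1 + \<dots> + n\<^sub>l\<^sub>+\<^sub>1\<close>, its weight collapses to the product over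
  \<open>r\<close> of the \<open>n\<^sub>r\<close>-th power of \<open>z\<^sub>r\<close> divided by \<open>(n\<^sub>r)\<^sub>q!\<close>, and the Whittaker function is the coefficient
  of \<open>t\<^sup>n\<close> in a product of \<open>q\<close>-exponential series (lemma \<open>whittaker_spec_eq\<close>).

  The two series agree by Euler's identity for the \<open>q\<close>-exponential, proved here through a
  \<open>q\<close>-difference equation: \<open>\<Prod>\<^sub>r (1 - z\<^sub>r t) F(t) = F(q t)\<close> has only one solution with \<open>F(0) = 1\<close> (lemma
  \<open>q_difference_unique\<close>). For \<open>H\<close> the factors on the left remove the variables \<open>a\<^sub>r\<^sub>,\<^sub>0\<close>, and shifting the
  index \<open>j\<close> of the others by one multiplies all values by \<open>q\<close>; for the \<open>q\<close>-exponentials the equation is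
  \<open>(m)\<^sub>q! = (1 - q\<^sup>m) (m - 1)\<^sub>q!\<close>.

  The analytic input is the unconditional summability of the values of all monomials of degree \<open>n\<close>
  (lemma \<open>summable_mon_eval\<close>). It yields the limit \<open>d \<rightarrow> \<infinity>\<close> at once, because the finite sets of monomials
  with \<open>j \<le> d\<close> exhaust the index set. It also makes the trace on the infinite-dimensional module
  independent of the eigenbasis: summability makes all eigenspaces of nonzero eigenvalues
  finite-dimensional (lemma \<open>has_trace_eigenbasis\<close>).
\<close>

abbreviation lookup where "lookup \<equiv> Poly_Mapping.lookup"
abbreviation keys where "keys \<equiv> Poly_Mapping.keys"
abbreviation single where "single \<equiv> Poly_Mapping.single"

section \<open>Traces and bases\<close>

text \<open>Write \<open>\<beta>\<close> and \<open>\<gamma>\<close> for the coordinates with respect to \<open>B\<close> and \<open>C\<close>. Both sides equal the double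
  sum of \<open>\<gamma>\<^sub>c(T b) \<beta>\<^sub>b(c)\<close> over \<open>b\<close> and \<open>c\<close>: for the left side expand \<open>T b\<close> in \<open>C\<close>, for the right
  side expand \<open>c\<close> in \<open>B\<close>.\<close>

lemma diagonal_sum_basis_change:
  assumes T: "module_hom cscale cscale T" and inv: "\<And>v. v \<in> V \<Longrightarrow> T v \<in> V"
    and B: "basis_of B V" "finite B" and C: "basis_of C V" "finite C"
  shows "(\<Sum>b\<in>B. cpoly.representation B (T b) b) = (\<Sum>c\<in>C. cpoly.representation C (T c) c)"
proof -
  let ?B = "cpoly.representation B" and ?C = "cpoly.representation C"
  have iB: "cpoly.independent B" "cpoly.span B = V" and iC: "cpoly.independent C" "cpoly.span C = V"
    using B C by (auto simp: basis_of_def)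
  have BV: "B \<subseteq> V" and CV: "C \<subseteq> V"
    using iB iC cpoly.span_superset by blast+
  interpret T: module_hom "cscale :: complex \<Rightarrow> 'a cpoly \<Rightarrow> 'a cpoly" cscale T by (fact T)
  have "?B (T b) b = (\<Sum>c\<in>C. ?C (T b) c * ?B c b)" if "b \<in> B" for b
  proof -
    have "T b \<in> cpoly.span C" using inv BV that iC by blast
    then have "T b = (\<Sum>c\<in>C. cscale (?C (T b) c) c)"
      using cpoly.sum_representation_eq[OF iC(1) _ C(2) subset_refl] by simp
    then have "?B (T b) = ?B (\<Sum>c\<in>C. cscale (?C (T b) c) c)" by simp
    also have "\<dots> = (\<lambda>x. \<Sum>c\<in>C. ?C (T b) c * ?B c x)"
      using CV iB cpoly.representation_scale[OF iB(1)]
      by (subst cpoly.representation_sum) (auto intro!: cpoly.span_scale ext sum.cong)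
    finally show ?thesis by metis
  qed
  then have "(\<Sum>b\<in>B. ?B (T b) b) = (\<Sum>b\<in>B. \<Sum>c\<in>C. ?C (T b) c * ?B c b)" by simp
  also have "\<dots> = (\<Sum>c\<in>C. \<Sum>b\<in>B. ?B c b * ?C (T b) c)"
    by (subst sum.swap) (simp add: mult.commute)
  also have "\<dots> = (\<Sum>c\<in>C. ?C (T c) c)"
  proof (rule sum.cong[OF refl])
    fix c assume c: "c \<in> C"
    have TbC: "T b \<in> cpoly.span C" if "b \<in> B" for b using inv BV that iC by blast
    have "c = (\<Sum>b\<in>B. cscale (?B c b) b)"
      using cpoly.sum_representation_eq[OF iB(1) _ B(2) subset_refl, of c] CV c iB by auto
    then have "T c = (\<Sum>b\<in>B. cscale (?B c b) (T b))"
      by (metis (no_types, lifting) T.sum T.scale sum.cong)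
    then have "?C (T c) = (\<lambda>x. \<Sum>b\<in>B. ?B c b * ?C (T b) x)"
      using TbC cpoly.representation_scale[OF iC(1)]
      by (simp add: cpoly.representation_sum[OF iC(1)] cpoly.span_scale)
    then show "(\<Sum>b\<in>B. ?B c b * ?C (T b) c) = ?C (T c) c" by simp
  qed
  finally show ?thesis .
qed

lemma fin_trace_eq:
  assumes "module_hom cscale cscale T" and "\<And>v. v \<in> V \<Longrightarrow> T v \<in> V"
    and C: "basis_of C V" "finite C"
  shows "fin_trace V T = (\<Sum>c\<in>C. cpoly.representation C (T c) c)"
proof -
  define B where "B = (SOME B. basis_of B V)"
  have B: "basis_of B V" unfolding B_def by (rule someI[of "\<lambda>B. basis_of B V" C, OF C(1)])
  then have "finite B"
    using C cpoly.independent_span_bound[of C B] cpoly.span_superset[of B]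
    by (auto simp: basis_of_def)
  with diagonal_sum_basis_change[OF assms(1,2) B _ C] show ?thesis
    by (simp add: fin_trace_def B_def Let_def)
qed

text \<open>Comparing coordinates in \<open>T v = a v\<close> shows that only basis vectors with eigenvalue \<open>a\<close> can occur
  in \<open>v\<close>. Hence the members of an eigenbasis with eigenvalue \<open>a\<close> form a basis of
  the eigenspace in \<open>V\<close>.\<close>

lemma eigenvector_in_span:
  assumes T: "module_hom cscale cscale T" and B: "eigenbasis_of B V T"
    and v: "v \<in> V" "T v = cscale a v"
  shows "v \<in> cpoly.span {b \<in> B. T b = cscale a b}"
proof -
  interpret T: module_hom "cscale :: complex \<Rightarrow> 'a cpoly \<Rightarrow> 'a cpoly" cscale T by (fact T)
  let ?r = "cpoly.representation B v"
  have iB: "cpoly.independent B" and vB: "v \<in> cpoly.span B"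
    using B v by (auto simp: eigenbasis_of_def basis_of_def)
  have BB: "b \<in> cpoly.span B" if "b \<in> B" for b
    using that by (rule cpoly.span_base)
  obtain ev where ev: "\<And>b. b \<in> B \<Longrightarrow> T b = cscale (ev b) b"
    using B unfolding eigenbasis_of_def by metis
  have sub: "{b. ?r b \<noteq> 0} \<subseteq> B" using cpoly.representation_ne_zero by blast
  have v_eq: "v = (\<Sum>b | ?r b \<noteq> 0. cscale (?r b) b)"
    using cpoly.sum_nonzero_representation_eq[OF iB vB] by simp
  then have "T v = (\<Sum>b | ?r b \<noteq> 0. cscale (?r b) (T b))"
    by (metis (no_types, lifting) T.sum T.scale sum.cong)
  also have "\<dots> = (\<Sum>b | ?r b \<noteq> 0. cscale (?r b * ev b) b)"
    using sub by (intro sum.cong) (auto simp: ev)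
  finally have Tv: "T v = (\<Sum>b | ?r b \<noteq> 0. cscale (?r b * ev b) b)" .
  have "T b = cscale a b" if b: "?r b \<noteq> 0" for b
  proof -
    have "a * ?r b = cpoly.representation B (T v) b"
      using v cpoly.representation_scale[OF iB vB] by simp
    also have "\<dots> = (\<Sum>x | ?r x \<noteq> 0. cpoly.representation B (cscale (?r x * ev x) x) b)"
      unfolding Tv using sub BB
      by (subst cpoly.representation_sum[OF iB]) (auto intro!: cpoly.span_scale)
    also have "\<dots> = (\<Sum>x | ?r x \<noteq> 0. if x = b then ?r x * ev x else 0)"
      using sub BB
      by (intro sum.cong refl)
        (auto simp: cpoly.representation_scale[OF iB] cpoly.representation_basis[OF iB])
    also have "\<dots> = ?r b * ev b"
      using b cpoly.finite_representation[of B v] by (simp add: sum.delta)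
    finally show ?thesis using b sub ev by auto
  qed
  then show ?thesis
    using sub by (subst v_eq) (intro cpoly.span_sum cpoly.span_scale cpoly.span_base, auto)
qed

lemma finite_level_set_if_summable:
  fixes f :: "'a \<Rightarrow> complex"
  assumes "f summable_on A" "a \<noteq> 0"
  shows "finite {x \<in> A. f x = a}"
proof (rule ccontr)
  assume inf: "infinite {x \<in> A. f x = a}"
  have "(\<lambda>x. norm (f x)) summable_on {x \<in> A. f x = a}"
    using assms(1) unfolding summable_on_iff_abs_summable_on_complex
    by (rule summable_on_subset_banach) auto
  then have "(\<lambda>_. norm a) summable_on {x \<in> A. f x = a}"
    by (rule summable_on_cong[THEN iffD1, rotated]) auto
  with infsum_diverge_constant[OF inf, of "norm a"] assms(2) show False by auto
qed

text \<open>A single eigenbasis with summable diagonal determines the trace. Each nonzero eigenvalue occurs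
  finitely often in it, because the diagonal is summable; so its eigenspace is finite-dimensional, and
  any other eigenbasis contains the same number of vectors with that eigenvalue. The two diagonals are
  then rearrangements of each other up to zeros, and unconditional sums do not see the difference.\<close>

lemma has_trace_eigenbasis:
  assumes T: "module_hom cscale cscale T" and C: "eigenbasis_of C V T"
    and t: "((\<lambda>c. cpoly.representation C (T c) c) has_sum t) C"
  shows "has_trace V T t"
  unfolding has_trace_def
proof (intro conjI allI impI)
  show "\<exists>B. eigenbasis_of B V T" using C by blast
  fix B assume B: "eigenbasis_of B V T"
  let ?d = "\<lambda>D b. cpoly.representation D (T b) b"
  have ev: "T b = cscale a b \<longleftrightarrow> ?d D b = a" if D: "eigenbasis_of D V T" and b: "b \<in> D" for D b a
  proof -
    have iD: "cpoly.independent D" using D by (auto simp: eigenbasis_of_def basis_of_def)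
    obtain a' where a': "T b = cscale a' b" using D b by (auto simp: eigenbasis_of_def)
    have "?d D b = a'"
      by (simp add: a' cpoly.representation_scale[OF iD cpoly.span_base[OF b]]
          cpoly.representation_basis[OF iD b])
    moreover have "b \<noteq> 0" using b iD cpoly.dependent_zero by blast
    ultimately show ?thesis using a' by auto
  qed
  \<comment> \<open>the eigenvectors in the basis \<open>D\<close> with eigenvalue \<open>a\<close>, a basis of the eigenspace\<close>
  define E where "E D a = {b \<in> D. T b = cscale a b}" for D a
  have E_eq: "E D a = {b \<in> D. ?d D b = a}" if "eigenbasis_of D V T" for D a
    using ev[OF that] by (auto simp: E_def)
  have sub: "E D a \<subseteq> cpoly.span (E D' a)"
    if "eigenbasis_of D V T" "eigenbasis_of D' V T" for D D' a
    using eigenvector_in_span[OF T that(2), of _ a] that(1) cpoly.span_superset[of D]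
    by (auto simp: E_def eigenbasis_of_def basis_of_def)
  have ind: "cpoly.independent (E D a)" if "eigenbasis_of D V T" for D a
    using that cpoly.independent_mono[of D "E D a"]
    by (auto simp: E_def eigenbasis_of_def basis_of_def)
  have "\<exists>h. bij_betw h (E B a) (E C a)" if "a \<noteq> 0" for a
  proof -
    have fC: "finite (E C a)"
      using finite_level_set_if_summable[OF has_sum_imp_summable[OF t] that] E_eq[OF C] by simp
    note B_le = cpoly.independent_span_bound[OF fC ind[OF B] sub[OF B C]]
    note C_le = cpoly.independent_span_bound[OF conjunct1[OF B_le] ind[OF C] sub[OF C B]]
    show ?thesis using B_le C_le fC by (intro finite_same_card_bij) auto
  qed
  then obtain h where h: "\<And>a. a \<noteq> 0 \<Longrightarrow> bij_betw (h a) (E B a) (E C a)" by metis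
  \<comment> \<open>The infinitely many vectors that the kernel may contain are left out: for them no bijection is
    available, and their diagonal coefficients vanish.\<close>
  define B' C' where "B' = {b \<in> B. ?d B b \<noteq> 0}" and "C' = {b \<in> C. ?d C b \<noteq> 0}"
  define g where "g b = h (?d B b) b" for b
  have gE: "g b \<in> E C (?d B b)" if "b \<in> B'" for b
    using that bij_betwE[OF h, of "?d B b"] E_eq[OF B] by (auto simp: g_def B'_def)
  have dg: "?d C (g b) = ?d B b" if "b \<in> B'" for b
    using gE[OF that] E_eq[OF C] by auto
  have bij: "bij_betw g B' C'"
  proof (rule bij_betw_imageI)
    show "inj_on g B'"
    proof (rule inj_onI)
      fix x y assume xy: "x \<in> B'" "y \<in> B'" "g x = g y"
      then have "?d B x = ?d B y" using dg by metis
      then show "x = y"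
        using xy bij_betw_imp_inj_on[OF h, of "?d B x"] E_eq[OF B]
        by (auto simp: g_def B'_def elim!: inj_onD)
    qed
    show "g ` B' = C'"
    proof safe
      fix b assume "b \<in> B'"
      then show "g b \<in> C'" using gE dg E_eq[OF C] by (auto simp: C'_def B'_def)
    next
      fix c assume c: "c \<in> C'"
      then have "c \<in> E C (?d C c)" using E_eq[OF C] by (auto simp: C'_def)
      then obtain b where b: "b \<in> E B (?d C c)" "c = h (?d C c) b"
        using c h[of "?d C c"] by (auto simp: C'_def bij_betw_def)
      then have "?d B b = ?d C c" "b \<in> B" using E_eq[OF B] by auto
      with b c show "c \<in> g ` B'" by (intro image_eqI[of _ _ b]) (auto simp: g_def B'_def C'_def)
    qed
  qed
  have "(?d C has_sum t) C' \<longleftrightarrow> (?d C has_sum t) C"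
    by (rule has_sum_cong_neutral) (auto simp: C'_def)
  moreover have "((\<lambda>b. ?d C (g b)) has_sum t) B' \<longleftrightarrow> (?d C has_sum t) C'"
    by (rule has_sum_reindex_bij_betw[OF bij])
  moreover have "((\<lambda>b. ?d C (g b)) has_sum t) B' \<longleftrightarrow> (?d B has_sum t) B'"
    by (rule has_sum_cong) (rule dg)
  moreover have "(?d B has_sum t) B' \<longleftrightarrow> (?d B has_sum t) B"
    by (rule has_sum_cong_neutral) (auto simp: B'_def)
  ultimately show "(?d B has_sum t) B" using t by blast
qed

section \<open>Operators that are diagonal on monomials\<close>

definition exponents :: "'v set \<Rightarrow> nat \<Rightarrow> ('v \<Rightarrow>\<^sub>0 nat) set" where
  "exponents X n = {e. keys e \<subseteq> X \<and> mon_degree e = n}"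

definition mon_eval :: "('v \<Rightarrow> complex) \<Rightarrow> ('v \<Rightarrow>\<^sub>0 nat) \<Rightarrow> complex" where
  "mon_eval c e = (\<Prod>v\<in>keys e. c v ^ lookup e v)"

lemma lookup_cscale: "lookup (cscale c f) e = c * lookup f e"
proof -
  have "cscale c f = Poly_Mapping.map ((*) c) f"
    by (simp add: cscale_def mult_map_scale_conv_mult)
  then show ?thesis by (simp add: map.rep_eq when_def)
qed

lemma prod_single:
  fixes f :: "'i \<Rightarrow> 'v :: comm_monoid_add" and g :: "'i \<Rightarrow> complex"
  shows "(\<Prod>v\<in>A. single (f v) (g v)) = single (\<Sum>v\<in>A. f v) (\<Prod>v\<in>A. g v)"
  by (induction A rule: infinite_finite_induct) (auto simp: mult_single)

lemma sum_single_keys: "(\<Sum>v\<in>keys e. single v (lookup e v)) = e"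
  by (rule poly_mapping_eqI)
    (auto simp: lookup_sum lookup_single when_def in_keys_iff sum.delta split: if_splits)

lemma lookup_dilate: "lookup (dilate c f) e = mon_eval c e * lookup f e"
proof -
  have "dilate c f = (\<Sum>e\<in>keys f. cscale (lookup f e) (single e (mon_eval c e)))"
    unfolding dilate_def mon_eval_def cscale_Var_power prod_single sum_single_keys ..
  then show ?thesis
    by (auto simp: lookup_sum lookup_cscale lookup_single when_def in_keys_iff if_distrib sum.delta
        cong: if_cong)
qed

lemma mon_eval_mult: "mon_eval (\<lambda>v. c v * d v) e = mon_eval c e * mon_eval d e"
  by (simp add: mon_eval_def power_mult_distrib prod.distrib)

definition diagonal :: "(('v \<Rightarrow>\<^sub>0 nat) \<Rightarrow> complex) \<Rightarrow> ('v cpoly \<Rightarrow> 'v cpoly) \<Rightarrow> bool" where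
  "diagonal w T \<longleftrightarrow> (\<forall>f e. lookup (T f) e = w e * lookup f e)"

definition monomials :: "('v \<Rightarrow>\<^sub>0 nat) set \<Rightarrow> 'v cpoly set" where
  "monomials E = (\<lambda>e. single e 1) ` E"

lemma diagonal_module_hom:
  assumes "diagonal w T"
  shows "module_hom cscale cscale T"
  using assms
  by unfold_locales
    (auto intro!: poly_mapping_eqI simp: diagonal_def lookup_add lookup_cscale algebra_simps)

lemma diagonal_monomial:
  assumes "diagonal w T"
  shows "T (single e 1) = cscale (w e) (single e 1)"
  using assms
  by (auto intro!: poly_mapping_eqI simp: diagonal_def lookup_cscale lookup_single when_def)

lemma diagonal_keys:
  assumes "diagonal w T"
  shows "keys (T f) \<subseteq> keys f"
  using assms by (auto simp: diagonal_def in_keys_iff)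

lemma inj_monomial: "inj_on (\<lambda>e. single e (1::complex)) E"
  by (rule inj_onI) (metis keys_single singleton_inject zero_neq_one)

lemma basis_of_monomials: "basis_of (monomials E) {f. keys f \<subseteq> E}"
  unfolding basis_of_def
proof
  show "cpoly.independent (monomials E)"
    unfolding cpoly.independent_explicit_module
  proof (intro allI impI)
    fix t u and v :: "'a cpoly"
    assume t: "finite t" "t \<subseteq> monomials E" "(\<Sum>v\<in>t. cscale (u v) v) = 0" "v \<in> t"
    then obtain e where e: "v = single e 1" by (auto simp: monomials_def)
    have "0 = lookup (\<Sum>v\<in>t. cscale (u v) v) e" using t by simp
    also have "\<dots> = (\<Sum>x\<in>t. if x = v then u x else 0)"
      unfolding lookup_sum
    proof (rule sum.cong[OF refl])
      fix x assume "x \<in> t"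
      then obtain e' where "x = single e' 1" using t by (auto simp: monomials_def)
      then show "lookup (cscale (u x) x) e = (if x = v then u x else 0)"
        using e inj_onD[OF inj_monomial, of e e' UNIV]
        by (auto simp: lookup_cscale lookup_single when_def)
    qed
    finally show "u v = 0" using t by (simp add: sum.delta)
  qed
next
  show "cpoly.span (monomials E) = {f. keys f \<subseteq> E}" (is "_ = ?V")
  proof
    have "cpoly.subspace ?V"
    proof (rule cpoly.subspaceI)
      fix f g :: "'a cpoly" assume "f \<in> ?V" "g \<in> ?V"
      then show "f + g \<in> ?V" using keys_add[of f g] by blast
    next
      fix a and f :: "'a cpoly" assume "f \<in> ?V"
      then show "cscale a f \<in> ?V" by (auto simp: in_keys_iff lookup_cscale)
    qed simp
    then show "cpoly.span (monomials E) \<subseteq> ?V"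
      by (intro cpoly.span_minimal) (auto simp: monomials_def)
  next
    show "?V \<subseteq> cpoly.span (monomials E)"
    proof
      fix f :: "'a cpoly" assume f: "f \<in> ?V"
      have "f = (\<Sum>e\<in>keys f. cscale (lookup f e) (single e 1))"
        by (rule poly_mapping_eqI)
          (auto simp: lookup_sum lookup_cscale lookup_single when_def in_keys_iff if_distrib sum.delta
            cong: if_cong)
      moreover have "single e 1 \<in> cpoly.span (monomials E)" if "e \<in> keys f" for e
        using f that by (intro cpoly.span_base) (auto simp: monomials_def)
      ultimately show "f \<in> cpoly.span (monomials E)"
        by (metis (no_types, lifting) cpoly.span_sum cpoly.span_scale)
    qed
  qed
qed

lemma representation_monomials:
  assumes "diagonal w T" "e \<in> E"
  shows "cpoly.representation (monomials E) (T (single e 1)) (single e 1) = w e"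
proof -
  have i: "cpoly.independent (monomials E)" and m: "single e 1 \<in> monomials E"
    using basis_of_monomials[of E] assms by (auto simp: basis_of_def monomials_def)
  show ?thesis
    unfolding diagonal_monomial[OF assms(1)]
      cpoly.representation_scale[OF i cpoly.span_base[OF m]] cpoly.representation_basis[OF i m]
    by simp
qed

lemma hom_polys_eq: "hom_polys X n = {f. keys f \<subseteq> exponents X n}"
  by (auto simp: hom_polys_def exponents_def)

section \<open>Sums over monomials of given degree\<close>

lemma mon_degree_eq_sum:
  assumes "finite A" "keys e \<subseteq> A"
  shows "mon_degree e = (\<Sum>v\<in>A. lookup e v)"
  unfolding mon_degree_def using assms by (intro sum.mono_neutral_left) (auto simp: in_keys_iff)

lemma mon_eval_eq_prod:
  assumes "finite A" "keys e \<subseteq> A"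
  shows "mon_eval c e = (\<Prod>v\<in>A. c v ^ lookup e v)"
  unfolding mon_eval_def using assms by (intro prod.mono_neutral_left) (auto simp: in_keys_iff)

lemma keys_add_nat: "keys (e + f) = keys e \<union> keys (f :: 'v \<Rightarrow>\<^sub>0 nat)"
  by (auto simp: in_keys_iff lookup_add)

lemma mon_degree_add: "mon_degree (e + f) = mon_degree e + mon_degree f"
  by (simp add: mon_degree_eq_sum[of "keys e \<union> keys f"] keys_add_nat lookup_add sum.distrib)

lemma mon_eval_add: "mon_eval c (e + f) = mon_eval c e * mon_eval c f"
  by (simp add: mon_eval_eq_prod[of "keys e \<union> keys f"] keys_add_nat lookup_add power_add prod.distrib)

lemma mon_degree_single [simp]: "mon_degree (single v m) = m"
  by (simp add: mon_degree_def)

lemma mon_eval_single [simp]: "mon_eval c (single v m) = c v ^ m"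
  by (simp add: mon_eval_def)

lemma mon_degree_eq_0_iff: "mon_degree e = 0 \<longleftrightarrow> e = 0"
  by (auto simp: mon_degree_def in_keys_iff intro: poly_mapping_eqI)

lemma exponents_0: "exponents X 0 = {0}"
  by (auto simp: exponents_def mon_degree_eq_0_iff)

lemma exponent_split:
  assumes "x \<in> keys (e :: 'v \<Rightarrow>\<^sub>0 nat)"
  shows "(e - single x 1) + single x 1 = e"
  using assms
  by (intro poly_mapping_eqI) (auto simp: lookup_add lookup_minus lookup_single when_def in_keys_iff)

lemma exponents_Suc_add:
  "x \<in> X \<Longrightarrow> e + single x 1 \<in> exponents X (Suc n) \<longleftrightarrow> e \<in> exponents X n"
  by (auto simp: exponents_def keys_add_nat mon_degree_add)

text \<open>Splitting off one variable from every monomial of degree \<open>n + 1\<close>, by an arbitrary choice,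
  loses no information. This bounds the monomials of degree \<open>n + 1\<close> by a product, so that finiteness
  and summability propagate from degree \<open>n\<close> to degree \<open>n + 1\<close>.\<close>

lemma exponents_Suc_embedding:
  obtains s where "inj_on s (exponents X (Suc n))" "s ` exponents X (Suc n) \<subseteq> X \<times> exponents X n"
    "\<And>e. e \<in> exponents X (Suc n) \<Longrightarrow> e = snd (s e) + single (fst (s e)) 1"
proof -
  have "\<exists>x. x \<in> keys e \<and> x \<in> X" if "e \<in> exponents X (Suc n)" for e
  proof -
    have "keys e \<noteq> {}" using that by (auto simp: exponents_def mon_degree_def)
    then obtain x where "x \<in> keys e" by blast
    then show ?thesis using that by (auto simp: exponents_def)
  qed
  then obtain x where x: "\<And>e. e \<in> exponents X (Suc n) \<Longrightarrow> x e \<in> keys e \<and> x e \<in> X" by metis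
  define s where "s e = (x e, e - single (x e) 1)" for e
  have s: "e = snd (s e) + single (fst (s e)) 1" if "e \<in> exponents X (Suc n)" for e
    using exponent_split[of "x e" e] x[OF that] by (simp add: s_def)
  show ?thesis
  proof
    show "inj_on s (exponents X (Suc n))" by (rule inj_onI) (metis s)
    show "s ` exponents X (Suc n) \<subseteq> X \<times> exponents X n"
    proof
      fix y assume "y \<in> s ` exponents X (Suc n)"
      then obtain e where e: "e \<in> exponents X (Suc n)" "y = s e" by blast
      then have "snd y \<in> exponents X n"
        using s[OF e(1)] exponents_Suc_add[of "x e" X "snd y" n] x[OF e(1)] by (simp add: s_def)
      then show "y \<in> X \<times> exponents X n" using x[OF e(1)] e by (auto simp: s_def)
    qed
  qed (rule s)
qed

lemma finite_exponents:
  assumes "finite X"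
  shows "finite (exponents X n)"
proof (induction n)
  case (Suc n)
  obtain s where "inj_on s (exponents X (Suc n))"
    "s ` exponents X (Suc n) \<subseteq> X \<times> exponents X n"
    by (rule exponents_Suc_embedding)
  then show ?case by (rule inj_on_finite) (use Suc assms in auto)
qed (simp add: exponents_0)

lemma summable_mon_eval:
  assumes "c summable_on X"
  shows "mon_eval c summable_on exponents X n"
proof (induction n)
  case (Suc n)
  obtain s where s: "inj_on s (exponents X (Suc n))"
    "s ` exponents X (Suc n) \<subseteq> X \<times> exponents X n"
    "\<And>e. e \<in> exponents X (Suc n) \<Longrightarrow> e = snd (s e) + single (fst (s e)) 1"
    by (rule exponents_Suc_embedding[of X n]) (rule that; assumption)
  define g where "g = (\<lambda>(x, e). mon_eval c e * c x)"
  have "(\<lambda>y. norm (g y)) summable_on X \<times> exponents X n"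
  proof (rule summable_on_SigmaI)
    show "((\<lambda>e. norm (g (x, e))) has_sum
        infsum (\<lambda>e. norm (mon_eval c e)) (exponents X n) * norm (c x)) (exponents X n)" for x
      unfolding g_def prod.case norm_mult
      using Suc[unfolded summable_on_iff_abs_summable_on_complex]
      by (intro has_sum_cmult_left has_sum_infsum)
    show "(\<lambda>x. infsum (\<lambda>e. norm (mon_eval c e)) (exponents X n) * norm (c x)) summable_on X"
      using assms[unfolded summable_on_iff_abs_summable_on_complex]
      by (intro summable_on_cmult_right)
  qed auto
  then have "g summable_on s ` exponents X (Suc n)"
    using s(2) by (rule summable_on_subset_banach[OF abs_summable_summable])
  then have "(g \<circ> s) summable_on exponents X (Suc n)"
    by (simp only: summable_on_reindex[OF s(1)])
  moreover have "(g \<circ> s) e = mon_eval c e" if "e \<in> exponents X (Suc n)" for e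
  proof -
    have "mon_eval c e = mon_eval c (snd (s e) + single (fst (s e)) 1)" using s(3)[OF that] by simp
    also have "\<dots> = (g \<circ> s) e"
      unfolding mon_eval_add mon_eval_single by (simp add: g_def case_prod_beta)
    finally show ?thesis by simp
  qed
  ultimately show ?case by (subst summable_on_cong[symmetric])
qed (simp add: exponents_0)

section \<open>Generating series of complete homogeneous sums\<close>

text \<open>The generating series, in the number of factors, of the complete homogeneous symmetric functions
  of the values \<open>c v\<close>, \<open>v \<in> X\<close>. For summable values it is the product of \<open>1 / (1 - c v t)\<close>.\<close>

definition hom_series :: "('v \<Rightarrow> complex) \<Rightarrow> 'v set \<Rightarrow> complex fps" where
  "hom_series c X = Abs_fps (\<lambda>n. infsum (mon_eval c) (exponents X n))"

lemma hom_series_0: "fps_nth (hom_series c X) 0 = 1"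
  by (simp add: hom_series_def exponents_0 mon_eval_def)

text \<open>A monomial of degree \<open>m + 1\<close> in \<open>x\<close> and \<open>Y\<close> either does not involve \<open>x\<close> or is \<open>x\<close> times a
  monomial of degree \<open>m\<close>. So each variable contributes a factor \<open>1 / (1 - c x t)\<close> to the series.\<close>

lemma hom_series_insert:
  assumes c: "c summable_on insert x Y" and x: "x \<notin> Y"
  shows "(1 - fps_const (c x) * fps_X) * hom_series c (insert x Y) = hom_series c Y"
proof (rule fps_ext)
  fix n
  let ?h = "\<lambda>Z n. infsum (mon_eval c) (exponents Z n)"
  have cY: "c summable_on Y" using c by (rule summable_on_subset_banach) auto
  show "fps_nth ((1 - fps_const (c x) * fps_X) * hom_series c (insert x Y)) n =
    fps_nth (hom_series c Y) n"
  proof (cases n)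
    case 0
    then show ?thesis by (simp add: hom_series_0)
  next
    case (Suc m)
    let ?S = "(\<lambda>e. e + single x 1) ` exponents (insert x Y) m"
    have inj: "inj_on (\<lambda>e. e + single x 1) (exponents (insert x Y) m)"
      by (rule inj_onI) simp
    have split: "exponents (insert x Y) (Suc m) = exponents Y (Suc m) \<union> ?S"
    proof (intro equalityI subsetI)
      fix e assume e: "e \<in> exponents (insert x Y) (Suc m)"
      show "e \<in> exponents Y (Suc m) \<union> ?S"
      proof (cases "x \<in> keys e")
        case True
        then have eq: "e = (e - single x 1) + single x 1" by (rule exponent_split[symmetric])
        then have "e - single x 1 \<in> exponents (insert x Y) m"
          using e exponents_Suc_add[of x "insert x Y" "e - single x 1" m] by (metis insertI1)
        with eq show ?thesis by blast
      qed (use e in \<open>auto simp: exponents_def\<close>)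
    next
      fix e assume "e \<in> exponents Y (Suc m) \<union> ?S"
      then show "e \<in> exponents (insert x Y) (Suc m)"
        using exponents_Suc_add[of x "insert x Y" _ m] by (auto simp: exponents_def)
    qed
    have disj: "exponents Y (Suc m) \<inter> ?S = {}"
      using x by (auto simp: exponents_def keys_add_nat)
    have "?h (insert x Y) (Suc m) = ?h Y (Suc m) + infsum (mon_eval c) ?S"
      unfolding split
    proof (rule infsum_Un_disjoint[OF summable_mon_eval[OF cY] _ disj])
      show "mon_eval c summable_on ?S"
        using summable_mon_eval[OF c, of "Suc m"]
        by (rule summable_on_subset_banach) (auto simp: split)
    qed
    also have "infsum (mon_eval c) ?S = c x * ?h (insert x Y) m"
      unfolding infsum_reindex[OF inj] o_def mon_eval_add mon_eval_single
      by (subst infsum_cmult_left') (simp add: mult.commute)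
    finally show ?thesis
      by (simp add: Suc hom_series_def left_diff_distrib mult.assoc)
  qed
qed

lemma hom_series_finite_Un:
  assumes "finite A" "c summable_on (A \<union> Y)" "A \<inter> Y = {}"
  shows "(\<Prod>a\<in>A. 1 - fps_const (c a) * fps_X) * hom_series c (A \<union> Y) = hom_series c Y"
  using assms
proof (induction A rule: finite_induct)
  case (insert x A)
  have "c summable_on (A \<union> Y)" using insert.prems(1) by (rule summable_on_subset_banach) auto
  then have "hom_series c Y = (\<Prod>a\<in>A. 1 - fps_const (c a) * fps_X) * hom_series c (A \<union> Y)"
    using insert by simp
  also have "hom_series c (A \<union> Y) =
      (1 - fps_const (c x) * fps_X) * hom_series c (insert x (A \<union> Y))"
    using insert hom_series_insert[of c x "A \<union> Y"] by simp
  finally show ?case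
    by (simp only: prod.insert[OF insert.hyps] Un_insert_left mult.assoc mult.left_commute)
qed simp

text \<open>Renaming variables by \<open>\<sigma>\<close> matches their monomials degree by degree. The case of interest is an
  injection of the variables into themselves whose image omits some of them.\<close>

lemma hom_series_image:
  assumes "inj \<sigma>"
  shows "hom_series c (\<sigma> ` X) = hom_series (c \<circ> \<sigma>) X"
proof -
  \<comment> \<open>\<open>push e\<close> is the exponent of the monomial obtained from \<open>e\<close> by the renaming.\<close>
  define push where "push e = (\<Sum>v\<in>keys e. single (\<sigma> v) (lookup e v))" for e :: "'a \<Rightarrow>\<^sub>0 nat"
  have lookup_push: "lookup (push e) (\<sigma> v) = lookup e v" for e v
    using assms
    by (auto simp: push_def lookup_sum lookup_single when_def inj_eq in_keys_iff sum.delta)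
  have keys_push: "keys (push e) = \<sigma> ` keys e" for e
  proof -
    have "lookup (push e) w = 0" if "w \<notin> range \<sigma>" for w
      using that by (auto simp: push_def lookup_sum lookup_single when_def intro!: sum.neutral)
    then have "keys (push e) \<subseteq> range \<sigma>" by (auto simp: in_keys_iff)
    then show ?thesis using lookup_push by (auto simp: in_keys_iff)
  qed
  have bij: "bij_betw push (exponents X n) (exponents (\<sigma> ` X) n)" for n
  proof (rule bij_betw_imageI)
    show "inj_on push (exponents X n)"
      by (rule inj_onI) (metis lookup_push poly_mapping_eqI)
    have deg: "mon_degree (push e) = mon_degree e" for e
      using assms
      by (simp add: mon_degree_def keys_push lookup_push sum.reindex inj_on_def inj_def)
    show "push ` exponents X n = exponents (\<sigma> ` X) n"
    proof (intro equalityI subsetI)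
      fix f assume "f \<in> push ` exponents X n"
      then show "f \<in> exponents (\<sigma> ` X) n"
        by (auto simp: exponents_def keys_push deg intro!: imageI)
    next
      fix f assume f: "f \<in> exponents (\<sigma> ` X) n"
      define e where "e = Poly_Mapping.map_key \<sigma> f"
      have le: "lookup e v = lookup f (\<sigma> v)" for v
        using assms by (simp add: e_def map_key.rep_eq)
      have "push e = f"
      proof (rule poly_mapping_eqI)
        fix w
        show "lookup (push e) w = lookup f w"
        proof (cases "w \<in> range \<sigma>")
          case False
          then have "w \<notin> keys (push e)" "w \<notin> keys f"
            using f by (auto simp: keys_push exponents_def)
          then show ?thesis by (simp add: in_keys_iff)
        qed (auto simp: lookup_push le)
      qed
      moreover have "keys e \<subseteq> X"
      proof
        fix v assume "v \<in> keys e"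
        then have "\<sigma> v \<in> \<sigma> ` X" using f by (auto simp: exponents_def le in_keys_iff subset_iff)
        then show "v \<in> X" using assms by (simp add: inj_image_mem_iff)
      qed
      ultimately show "f \<in> push ` exponents X n"
        using f deg[of e] by (auto simp: exponents_def)
    qed
  qed
  have "mon_eval c (push e) = mon_eval (c \<circ> \<sigma>) e" for e
    using assms by (simp add: mon_eval_def keys_push lookup_push prod.reindex inj_on_def inj_def)
  then have "infsum (mon_eval c) (exponents (\<sigma> ` X) n) = infsum (mon_eval (c \<circ> \<sigma>)) (exponents X n)"
    for n using infsum_reindex_bij_betw[OF bij, of "mon_eval c"] by simp
  then show ?thesis by (simp add: hom_series_def)
qed

lemma hom_series_scale:
  "hom_series (\<lambda>v. a * c v) X = hom_series c X oo (fps_const a * fps_X)"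
proof (rule fps_ext)
  fix n
  have "mon_eval (\<lambda>v. a * c v) e = a ^ n * mon_eval c e" if "e \<in> exponents X n" for e
  proof -
    have "mon_eval (\<lambda>_. a) e = a ^ n"
      using that by (auto simp: exponents_def mon_eval_def mon_degree_def power_sum)
    then show ?thesis by (simp add: mon_eval_mult)
  qed
  then have "infsum (mon_eval (\<lambda>v. a * c v)) (exponents X n) =
    infsum (\<lambda>e. a ^ n * mon_eval c e) (exponents X n)" by (rule infsum_cong)
  then show "fps_nth (hom_series (\<lambda>v. a * c v) X) n =
    fps_nth (hom_series c X oo (fps_const a * fps_X)) n"
    by (simp add: hom_series_def infsum_cmult_right')
qed

section \<open>A q-difference equation\<close>

text \<open>Comparing coefficients of \<open>t\<^sup>n\<close> in \<open>P(t) F(t) = F(q t)\<close> expresses \<open>(1 - q\<^sup>n) F\<^sub>n\<close> through lower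
  coefficients of \<open>F\<close>, and \<open>1 - q\<^sup>n\<close> is invertible.\<close>

lemma q_difference_unique:
  fixes F G P :: "complex fps"
  assumes F: "P * F = F oo (fps_const q * fps_X)" and G: "P * G = G oo (fps_const q * fps_X)"
    and P: "fps_nth P 0 = 1" and q: "\<And>n. n > 0 \<Longrightarrow> q ^ n \<noteq> 1"
    and FG0: "fps_nth F 0 = fps_nth G 0"
  shows "F = G"
proof -
  define D where "D = F - G"
  have D: "P * D = D oo (fps_const q * fps_X)"
    using F G by (simp add: D_def right_diff_distrib fps_compose_sub_distrib)
  have "fps_nth D n = 0" for n
  proof (induction n rule: less_induct)
    case (less n)
    show ?case
    proof (cases "n = 0")
      case True
      then show ?thesis using FG0 by (simp add: D_def)
    next
      case False
      have "q ^ n * fps_nth D n = fps_nth (P * D) n" by (simp add: D)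
      also have "\<dots> = (\<Sum>i=0..n. fps_nth P i * fps_nth D (n - i))" by (rule fps_mult_nth)
      also have "\<dots> = (\<Sum>i\<in>{0}. fps_nth P i * fps_nth D (n - i))"
        using less False by (intro sum.mono_neutral_right) auto
      finally show ?thesis using P q[of n] False by simp
    qed
  qed
  then show ?thesis by (auto simp: D_def fps_eq_iff)
qed

text \<open>Euler's \<open>q\<close>-exponential of \<open>a t\<close>.\<close>

definition qexp_series :: "complex \<Rightarrow> complex \<Rightarrow> complex fps" where
  "qexp_series q a = Abs_fps (\<lambda>m. a ^ m / qfact q m)"

lemma qfact_Suc: "qfact q (Suc m) = (1 - q ^ Suc m) * qfact q m"
  by (simp add: qfact_def mult.commute)

lemma qfact_0 [simp]: "qfact q 0 = 1"
  by (simp add: qfact_def)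

lemma power_ne_1: "norm q < 1 \<Longrightarrow> n > 0 \<Longrightarrow> q ^ n \<noteq> (1 :: complex)"
  by (metis norm_one norm_power power_less_one_iff norm_ge_zero less_irrefl not_gr_zero)

lemma qfact_nonzero: "norm q < 1 \<Longrightarrow> qfact q m \<noteq> 0"
  using power_ne_1 by (force simp: qfact_def)

lemma qexp_series_q_difference:
  assumes "norm q < 1"
  shows "(1 - fps_const a * fps_X) * qexp_series q a = qexp_series q a oo (fps_const q * fps_X)"
proof (rule fps_ext)
  fix n
  show "fps_nth ((1 - fps_const a * fps_X) * qexp_series q a) n =
    fps_nth (qexp_series q a oo (fps_const q * fps_X)) n"
  proof (cases n)
    case (Suc m)
    have "qfact q m \<noteq> 0" "1 - q ^ Suc m \<noteq> 0"
      using qfact_nonzero power_ne_1[of q "Suc m"] assms by auto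
    then show ?thesis
      by (simp add: Suc qexp_series_def left_diff_distrib mult.assoc qfact_Suc divide_simps
          del: power_Suc) (simp add: algebra_simps)
  qed (simp add: qexp_series_def)
qed

section \<open>The Whittaker function at a one-row weight\<close>

text \<open>The highest weight of the \<open>n\<close>-th symmetric power of the standard representation, twisted by the
  \<open>k\<close>-th power of the determinant.\<close>

definition one_row :: "int \<Rightarrow> int \<Rightarrow> nat \<Rightarrow> int" where
  "one_row n k = (\<lambda>i. if i = 1 then n + k else k)"

text \<open>The Gelfand-Zetlin conditions below a top row \<open>(n + k, k, \<dots>, k)\<close> force all entries to be \<open>k\<close>
  except those in the first column. The array is therefore given by the increments
  \<open>v = (p\<^sub>1\<^sub>1 - k, p\<^sub>2\<^sub>1 - p\<^sub>1\<^sub>1, \<dots>)\<close> of its first column, which form a composition of \<open>n\<close> with zero parts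
  allowed. The list is indexed from \<open>0\<close>, so its entry \<open>j\<close> is the increment that leads to row \<open>j + 1\<close>.\<close>

definition one_row_array :: "nat \<Rightarrow> int \<Rightarrow> nat list \<Rightarrow> nat \<Rightarrow> nat \<Rightarrow> int" where
  "one_row_array l k v r i =
     (if 1 \<le> i \<and> i \<le> r \<and> r \<le> l + 1 then k + (if i = 1 then int (\<Sum>j<r. v ! j) else 0) else 0)"

lemma one_row_array_GZ:
  assumes "v \<in> natpermute n (l + 1)"
  shows "one_row_array l k v \<in> GZ_arrays l (one_row (int n) k)"
proof -
  have "sum_list v = (\<Sum>j<l+1. v ! j)"
    using assms by (auto simp: natpermute_def sum_list_sum_nth atLeast0LessThan)
  then have n: "n = (\<Sum>j<l+1. v ! j)" using assms by (simp add: natpermute_def)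
  show ?thesis
    unfolding GZ_arrays_def mem_Collect_eq
  proof (intro conjI ballI)
    fix i assume "i \<in> {1..l+1}"
    then show "one_row_array l k v (l + 1) i = one_row (int n) k i"
      unfolding n by (auto simp: one_row_array_def one_row_def)
  next
    fix r i assume "r \<in> {1..l}" "i \<in> {1..r}"
    then show "one_row_array l k v r i \<le> one_row_array l k v (r + 1) i"
      "one_row_array l k v (r + 1) (i + 1) \<le> one_row_array l k v r i"
      by (auto simp: one_row_array_def sum_nonneg)
  qed (auto simp: one_row_array_def)
qed

text \<open>Downward from the top row: an entry off the first column is squeezed between two neighbours in the
  row above, both equal to \<open>k\<close>.\<close>

lemma GZ_one_row_entry:
  assumes P: "P \<in> GZ_arrays l (one_row n k)" and "2 \<le> i" "i \<le> r" "r \<le> l + 1"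
  shows "P r i = k"
  using assms(4,2,3)
proof (induction r arbitrary: i rule: inc_induct)
  case base
  then show ?case using P by (auto simp: GZ_arrays_def one_row_def)
next
  case (step r)
  have "P r i \<le> P (r + 1) i \<and> P (r + 1) (i + 1) \<le> P r i"
    using P step.hyps step.prems by (auto simp: GZ_arrays_def)
  then show ?case using step.IH[of i] step.IH[of "i + 1"] step.prems by simp
qed

lemma GZ_one_row_first:
  assumes P: "P \<in> GZ_arrays l (one_row n k)" and "n \<ge> 0" "1 \<le> r" "r \<le> l + 1"
  shows "k \<le> P r 1" "r \<le> l \<Longrightarrow> P r 1 \<le> P (r + 1) 1"
proof -
  show "k \<le> P r 1"
  proof (cases "r = l + 1")
    case True
    then show ?thesis using P assms(2) by (auto simp: GZ_arrays_def one_row_def)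
  next
    case False
    then have "P (r + 1) 2 \<le> P r 1" using P assms(3,4) by (force simp: GZ_arrays_def numeral_2_eq_2)
    moreover have "P (r + 1) 2 = k" using GZ_one_row_entry[OF P] False assms by simp
    ultimately show ?thesis by simp
  qed
  show "P r 1 \<le> P (r + 1) 1" if "r \<le> l"
    using P assms(3) that by (auto simp: GZ_arrays_def)
qed

text \<open>The inverse of \<open>one_row_array\<close>. The increment into the first row counts from \<open>k\<close>, the lower bound of
  the first column.\<close>

definition first_increments :: "nat \<Rightarrow> int \<Rightarrow> (nat \<Rightarrow> nat \<Rightarrow> int) \<Rightarrow> nat list" where
  "first_increments l k P = map (\<lambda>j. nat (P (j + 1) 1 - (if j = 0 then k else P j 1))) [0..<l + 1]"

lemma sum_first_increments:
  assumes P: "P \<in> GZ_arrays l (one_row n k)" and n: "n \<ge> 0" and r: "1 \<le> r" "r \<le> l + 1"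
  shows "int (\<Sum>j<r. first_increments l k P ! j) = P r 1 - k"
  using r
proof (induction r rule: dec_induct)
  case base
  then show ?case using GZ_one_row_first(1)[OF P n, of 1] by (simp add: first_increments_def del: upt_Suc)
next
  case (step r)
  then show ?case
    using GZ_one_row_first(2)[OF P n, of r] by (simp add: first_increments_def del: upt_Suc)
qed

lemma bij_one_row_array:
  "bij_betw (one_row_array l k) (natpermute n (l + 1)) (GZ_arrays l (one_row (int n) k))"
proof (rule bij_betw_byWitness[where f' = "first_increments l k"])
  show "\<forall>v\<in>natpermute n (l + 1). first_increments l k (one_row_array l k v) = v"
    by (auto simp: natpermute_def first_increments_def one_row_array_def intro!: nth_equalityI
        simp del: upt_Suc)
  show "\<forall>P\<in>GZ_arrays l (one_row (int n) k). one_row_array l k (first_increments l k P) = P"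
  proof
    fix P assume P: "P \<in> GZ_arrays l (one_row (int n) k)"
    show "one_row_array l k (first_increments l k P) = P"
    proof (intro ext)
      fix r i
      show "one_row_array l k (first_increments l k P) r i = P r i"
      proof (cases "1 \<le> i \<and> i \<le> r \<and> r \<le> l + 1")
        case True
        then show ?thesis
          using sum_first_increments[OF P, of r] GZ_one_row_entry[OF P, of i r]
          by (cases "i = 1") (auto simp: one_row_array_def)
      next
        case False
        then show ?thesis using P by (auto simp: one_row_array_def GZ_arrays_def)
      qed
    qed
  qed
  show "one_row_array l k ` natpermute n (l + 1) \<subseteq> GZ_arrays l (one_row (int n) k)"
    using one_row_array_GZ by blast
  show "first_increments l k ` GZ_arrays l (one_row (int n) k) \<subseteq> natpermute n (l + 1)"
  proof
    fix v assume "v \<in> first_increments l k ` GZ_arrays l (one_row (int n) k)"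
    then obtain P where P: "P \<in> GZ_arrays l (one_row (int n) k)" "v = first_increments l k P" by blast
    have len: "length v = l + 1" by (simp add: P first_increments_def)
    have "int (\<Sum>j<l+1. v ! j) = n"
      using sum_first_increments[OF P(1), of "l + 1"] P by (simp add: GZ_arrays_def one_row_def)
    then have "sum_list v = n"
      using len by (simp add: sum_list_sum_nth atLeast0LessThan del: of_nat_sum)
    then show "v \<in> natpermute n (l + 1)" using len by (simp add: natpermute_def)
  qed
qed

lemma prod_first_only:
  fixes f :: "nat \<Rightarrow> 'a :: comm_monoid_mult"
  assumes "\<And>i. 2 \<le> i \<Longrightarrow> i \<le> r \<Longrightarrow> f i = 1" "1 \<le> r"
  shows "(\<Prod>i=1..r. f i) = f 1"
proof -
  have "(\<Prod>i=1..r. f i) = (\<Prod>i\<in>{1}. f i)"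
    using assms by (intro prod.mono_neutral_right) auto
  then show ?thesis by simp
qed

text \<open>Put \<open>m\<^sub>r = p\<^sub>r\<^sub>1 - k\<close>. Only factors from the first column differ from \<open>1\<close>, and the quotient of
  \<open>q\<close>-factorials becomes \<open>(m\<^sub>2)! \<dots> (m\<^sub>l)!\<close> over the product of \<open>(m\<^sub>r)! (m\<^sub>r\<^sub>+\<^sub>1 - m\<^sub>r)!\<close> for \<open>r = 1, \<dots>, l\<close>.
  After cancellation there remains \<open>(m\<^sub>1)!\<close> in the denominator, which is the factorial of the first
  increment.\<close>

lemma GZ_weight_one_row:
  assumes v: "v \<in> natpermute n (l + 1)" and l: "l \<ge> 1"
    and q: "norm q < 1" and z: "\<And>r. 1 \<le> r \<Longrightarrow> r \<le> l + 1 \<Longrightarrow> z r \<noteq> 0"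
  shows "GZ_weight l q z (one_row_array l k v) =
    (\<Prod>r=1..l+1. z r powi k) * (\<Prod>j=0..l. z (j + 1) ^ (v ! j) / qfact q (v ! j))"
proof -
  define m where "m r = (\<Sum>j<r. v ! j)" for r
  let ?P = "one_row_array l k v"
  have P1: "?P r 1 = k + int (m r)" if "1 \<le> r" "r \<le> l + 1" for r
    using that by (simp add: one_row_array_def m_def)
  have P2: "?P r i = k" if "2 \<le> i" "i \<le> r" "r \<le> l + 1" for r i
    using that by (simp add: one_row_array_def)
  have mS: "m (r + 1) = m r + v ! r" for r by (simp add: m_def)
  have row: "(\<Sum>i=1..r. ?P r i) = int r * k + int (m r)" if "r \<le> l + 1" for r
  proof (cases r)
    case (Suc r')
    have "(\<Sum>i=1..r. ?P r i) = (\<Sum>i=1..r. k + (if i = 1 then int (m r) else 0))"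
      using that by (intro sum.cong) (auto simp: one_row_array_def m_def)
    also have "\<dots> = int r * k + int (m r)" by (simp add: sum.distrib Suc)
    finally show ?thesis .
  qed (simp add: m_def)
  have "(\<Prod>r=1..l+1. z r powi ((\<Sum>i=1..r. ?P r i) - (\<Sum>i=1..r-1. ?P (r - 1) i))) =
    (\<Prod>r=1..l+1. z r powi k * z r ^ (v ! (r - 1)))"
  proof (rule prod.cong[OF refl])
    fix r assume r: "r \<in> {1..l+1}"
    then have "(\<Sum>i=1..r. ?P r i) - (\<Sum>i=1..r-1. ?P (r - 1) i) = k + int (v ! (r - 1))"
      using row[of r] row[of "r - 1"] mS[of "r - 1"]
      by (auto simp: algebra_simps of_nat_diff)
    then show "z r powi ((\<Sum>i=1..r. ?P r i) - (\<Sum>i=1..r-1. ?P (r - 1) i)) =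
      z r powi k * z r ^ (v ! (r - 1))"
      using z[of r] r by (simp add: power_int_add)
  qed
  also have "\<dots> = (\<Prod>r=1..l+1. z r powi k) * (\<Prod>j=0..l. z (j + 1) ^ (v ! j))"
    using prod.shift_bounds_cl_Suc_ivl[of "\<lambda>r. z r ^ (v ! (r - 1))" 0 l]
    by (simp add: prod.distrib)
  finally have torus: "(\<Prod>r=1..l+1. z r powi ((\<Sum>i=1..r. ?P r i) - (\<Sum>i=1..r-1. ?P (r - 1) i))) =
    (\<Prod>r=1..l+1. z r powi k) * (\<Prod>j=0..l. z (j + 1) ^ (v ! j))" .
  have num: "(\<Prod>r=2..l. \<Prod>i=1..r-1. qfact q (nat (?P r i - ?P r (i + 1)))) =
    (\<Prod>r=2..l. qfact q (m r))"
  proof (rule prod.cong[OF refl])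
    fix r assume r: "r \<in> {2..l}"
    then have "(\<Prod>i=1..r-1. qfact q (nat (?P r i - ?P r (i + 1)))) =
      qfact q (nat (?P r 1 - ?P r (1 + 1)))"
      by (intro prod_first_only) (auto simp: P2)
    then show "(\<Prod>i=1..r-1. qfact q (nat (?P r i - ?P r (i + 1)))) = qfact q (m r)"
      using P1[of r] P2[of 2 r] r by (simp add: numeral_2_eq_2)
  qed
  have den: "(\<Prod>r=1..l. \<Prod>i=1..r. qfact q (nat (?P (r + 1) i - ?P r i)) *
      qfact q (nat (?P r i - ?P (r + 1) (i + 1)))) =
    (\<Prod>r=1..l. qfact q (v ! r) * qfact q (m r))"
  proof (rule prod.cong[OF refl])
    fix r assume r: "r \<in> {1..l}"
    then have "(\<Prod>i=1..r. qfact q (nat (?P (r + 1) i - ?P r i)) *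
      qfact q (nat (?P r i - ?P (r + 1) (i + 1)))) =
      qfact q (nat (?P (r + 1) 1 - ?P r 1)) * qfact q (nat (?P r 1 - ?P (r + 1) (1 + 1)))"
      by (intro prod_first_only) (auto simp: P2)
    then show "(\<Prod>i=1..r. qfact q (nat (?P (r + 1) i - ?P r i)) *
      qfact q (nat (?P r i - ?P (r + 1) (i + 1)))) = qfact q (v ! r) * qfact q (m r)"
      using P1[of r] P1[of "r + 1"] P2[of 2 "r + 1"] r mS[of r] by (simp add: numeral_2_eq_2)
  qed
  have "(\<Prod>r=1..l. qfact q (m r)) = qfact q (v ! 0) * (\<Prod>r=2..l. qfact q (m r))"
    using l by (simp add: prod.atLeast_Suc_atMost m_def numeral_2_eq_2)
  moreover have "(\<Prod>j=0..l. qfact q (v ! j)) = qfact q (v ! 0) * (\<Prod>r=1..l. qfact q (v ! r))"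
    by (simp add: prod.atLeast_Suc_atMost)
  moreover have "(\<Prod>r=2..l. qfact q (m r)) \<noteq> 0"
    using qfact_nonzero[OF q] by simp
  ultimately have "(\<Prod>r=2..l. qfact q (m r)) / (\<Prod>r=1..l. qfact q (v ! r) * qfact q (m r)) =
    1 / (\<Prod>j=0..l. qfact q (v ! j))"
    by (simp add: prod.distrib)
  then show ?thesis
    unfolding GZ_weight_def torus num den by (simp add: prod_dividef)
qed

lemma whittaker_spec_eq:
  assumes l: "l \<ge> 1" and q: "norm q < 1" and z: "\<And>r. 1 \<le> r \<Longrightarrow> r \<le> l + 1 \<Longrightarrow> z r \<noteq> 0"
  shows "whittaker_spec l q z (int n) k =
    (\<Prod>r=1..l+1. z r powi k) * fps_nth (\<Prod>j=0..l. qexp_series q (z (j + 1))) n"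
proof -
  have "whittaker_spec l q z (int n) k = (\<Sum>P\<in>GZ_arrays l (one_row (int n) k). GZ_weight l q z P)"
    by (simp add: whittaker_spec_def whittaker_def one_row_def)
  also have "\<dots> = (\<Sum>v\<in>natpermute n (l + 1). GZ_weight l q z (one_row_array l k v))"
    using sum.reindex_bij_betw[OF bij_one_row_array, of "GZ_weight l q z" l k n] by simp
  also have "\<dots> = (\<Sum>v\<in>natpermute n (l + 1). (\<Prod>r=1..l+1. z r powi k) *
    (\<Prod>j=0..l. z (j + 1) ^ (v ! j) / qfact q (v ! j)))"
    by (rule sum.cong[OF refl], rule GZ_weight_one_row) (use assms in auto)
  also have "\<dots> = (\<Prod>r=1..l+1. z r powi k) * fps_nth (\<Prod>j=0..l. qexp_series q (z (j + 1))) n"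
    by (simp add: fps_prod_nth qexp_series_def sum_distrib_left)
  finally show ?thesis .
qed

section \<open>The characters\<close>

lemma fin_trace_diagonal:
  assumes T: "diagonal w T" and X: "finite X"
  shows "fin_trace (hom_polys X n) T = (\<Sum>e\<in>exponents X n. w e)"
proof -
  let ?E = "exponents X n"
  have "fin_trace (hom_polys X n) T =
      (\<Sum>b\<in>monomials ?E. cpoly.representation (monomials ?E) (T b) b)"
    unfolding hom_polys_eq
    using diagonal_module_hom[OF T] diagonal_keys[OF T] finite_exponents[OF X]
    by (intro fin_trace_eq basis_of_monomials) (auto simp: monomials_def)
  also have "\<dots> =
      (\<Sum>e\<in>?E. cpoly.representation (monomials ?E) (T (single e 1)) (single e 1))"
    unfolding monomials_def by (subst sum.reindex[OF inj_monomial]) simp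
  also have "\<dots> = (\<Sum>e\<in>?E. w e)"
    by (intro sum.cong refl representation_monomials[OF T])
  finally show ?thesis .
qed

lemma has_trace_diagonal:
  assumes T: "diagonal w T" and t: "(w has_sum t) (exponents X n)"
  shows "has_trace (hom_polys X n) T t"
proof (rule has_trace_eigenbasis[OF diagonal_module_hom[OF T]])
  let ?E = "exponents X n"
  show "eigenbasis_of (monomials ?E) (hom_polys X n) T"
    unfolding eigenbasis_of_def hom_polys_eq
    using basis_of_monomials diagonal_monomial[OF T] by (auto simp: monomials_def)
  have "((\<lambda>e. cpoly.representation (monomials ?E) (T (single e 1)) (single e 1)) has_sum t) ?E \<longleftrightarrow>
      (w has_sum t) ?E"
    by (intro has_sum_cong representation_monomials[OF T])
  with t have "((\<lambda>e. cpoly.representation (monomials ?E) (T (single e 1)) (single e 1))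
      has_sum t) ?E" by simp
  then show "((\<lambda>b. cpoly.representation (monomials ?E) (T b) b) has_sum t) (monomials ?E)"
    using has_sum_reindex[OF inj_monomial, of _ ?E t] by (simp add: monomials_def o_def)
qed

definition variable_value :: "complex \<Rightarrow> (nat \<Rightarrow> complex) \<Rightarrow> nat \<times> nat \<Rightarrow> complex" where
  "variable_value q z = (\<lambda>(r, j). q ^ j * z (r + 1))"

lemma diagonal_torus_action:
  "diagonal (\<lambda>e. (\<Prod>i=1..l+1. exp (lam i) powi k) * mon_eval (variable_value q (\<lambda>i. exp (lam i))) e)
    (q_L0 q \<circ> exp_H l k lam)"
proof -
  have "variable_value q (\<lambda>i. exp (lam i)) =
      (\<lambda>v. (case v of (r, j) \<Rightarrow> q ^ j) * (case v of (r, j) \<Rightarrow> exp (lam (r + 1))))"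
    by (auto simp: variable_value_def)
  then show ?thesis
    by (simp add: diagonal_def q_L0_def exp_H_def lookup_dilate lookup_cscale mon_eval_mult)
qed

lemma summable_variable_value:
  assumes "norm q < 1"
  shows "variable_value q z summable_on {0..l} \<times> UNIV"
proof -
  have "(\<lambda>j. q ^ j) summable_on UNIV"
    using assms by (intro norm_summable_imp_summable_on) (simp add: norm_power)
  then have row: "(\<lambda>j. norm (q ^ j * z (r + 1))) summable_on UNIV" for r
    unfolding summable_on_iff_abs_summable_on_complex[symmetric] by (rule summable_on_cmult_left)
  have "(\<lambda>v. norm (variable_value q z v)) summable_on {0..l} \<times> UNIV"
  proof (rule summable_on_SigmaI)
    show "((\<lambda>j. norm (variable_value q z (r, j))) has_sum
        infsum (\<lambda>j. norm (q ^ j * z (r + 1))) UNIV) UNIV" for r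
      using has_sum_infsum[OF row] by (simp add: variable_value_def)
  qed auto
  then show ?thesis by (simp only: summable_on_iff_abs_summable_on_complex)
qed

text \<open>Euler's identity in several variables: the two sides solve the same \<open>q\<close>-difference equation.
  On the left, removing the variables \<open>(r, 0)\<close> leaves the image of all variables under the shift of
  the second index, along which the values are multiplied by \<open>q\<close>.\<close>

lemma hom_series_eq_prod_qexp:
  assumes q: "norm q < 1"
  shows "hom_series (variable_value q z) ({0..l} \<times> UNIV) = (\<Prod>r=0..l. qexp_series q (z (r + 1)))"
proof (rule q_difference_unique)
  let ?c = "variable_value q z" and ?X = "{0..l} \<times> (UNIV :: nat set)"
  let ?P = "\<Prod>r=0..l. 1 - fps_const (z (r + 1)) * fps_X"
  define \<sigma> where "\<sigma> = (\<lambda>(r :: nat, j). (r, Suc j))"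
  let ?A = "(\<lambda>r. (r, 0 :: nat)) ` {0..l}"
  have inj: "inj \<sigma>" by (auto simp: inj_def \<sigma>_def)
  have X: "?X = ?A \<union> \<sigma> ` ?X"
  proof (intro equalityI subsetI)
    fix v assume v: "v \<in> ?X"
    then show "v \<in> ?A \<union> \<sigma> ` ?X"
      by (cases "snd v") (force simp: \<sigma>_def image_iff)+
  qed (auto simp: \<sigma>_def)
  have c\<sigma>: "?c \<circ> \<sigma> = (\<lambda>v. q * ?c v)"
    by (auto simp: variable_value_def \<sigma>_def)
  have "?P = (\<Prod>a\<in>?A. 1 - fps_const (?c a) * fps_X)"
    by (subst prod.reindex) (auto simp: inj_on_def variable_value_def)
  then have "?P * hom_series ?c ?X =
      (\<Prod>a\<in>?A. 1 - fps_const (?c a) * fps_X) * hom_series ?c (?A \<union> \<sigma> ` ?X)"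
    using X by simp
  also have "\<dots> = hom_series ?c (\<sigma> ` ?X)"
  proof (rule hom_series_finite_Un)
    show "?c summable_on ?A \<union> \<sigma> ` ?X"
      using summable_variable_value[OF q, of z l] X by simp
  qed (auto simp: \<sigma>_def)
  also have "\<dots> = hom_series ?c ?X oo (fps_const q * fps_X)"
    by (simp only: hom_series_image[OF inj] c\<sigma> hom_series_scale)
  finally show "?P * hom_series ?c ?X = hom_series ?c ?X oo (fps_const q * fps_X)" .
  show "?P * (\<Prod>r=0..l. qexp_series q (z (r + 1))) =
      (\<Prod>r=0..l. qexp_series q (z (r + 1))) oo (fps_const q * fps_X)"
    by (simp add: fps_compose_prod_distrib qexp_series_q_difference[OF q] flip: prod.distrib)
  have prod0: "fps_nth (\<Prod>r=0..l. F r) 0 = 1" if "\<And>r. fps_nth (F r) 0 = 1"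
    for F :: "nat \<Rightarrow> complex fps"
    using that by (induction l) (auto simp: prod.atLeast0_atMost_Suc)
  show "fps_nth ?P 0 = 1" by (rule prod0) simp
  show "fps_nth (hom_series ?c ?X) 0 = fps_nth (\<Prod>r=0..l. qexp_series q (z (r + 1))) 0"
    by (subst prod0) (simp_all add: hom_series_0 qexp_series_def)
qed (rule power_ne_1[OF q])

text \<open>A finite set of monomials involves only finitely many variables, hence lies in one of the
  truncations.\<close>

lemma filterlim_truncated_exponents:
  fixes l n :: nat
  shows "filterlim (\<lambda>d. exponents ({0..l} \<times> {0..d}) n)
    (finite_subsets_at_top (exponents ({0..l} \<times> (UNIV :: nat set)) n)) sequentially"
  unfolding filterlim_finite_subsets_at_top
proof (intro allI impI, elim conjE)
  fix F assume F: "finite F" "F \<subseteq> exponents ({0..l} \<times> (UNIV :: nat set)) n"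
  have "finite (snd ` (\<Union>e\<in>F. keys e))" using F by simp
  then obtain N where N: "\<forall>j \<in> snd ` (\<Union>e\<in>F. keys e). j \<le> N"
    unfolding finite_nat_set_iff_bounded_le ..
  show "\<forall>\<^sub>F d in sequentially. finite (exponents ({0..l} \<times> {0..d}) n) \<and>
      F \<subseteq> exponents ({0..l} \<times> {0..d}) n \<and>
      exponents ({0..l} \<times> {0..d}) n \<subseteq> exponents ({0..l} \<times> UNIV) n"
    using eventually_ge_at_top[of N]
  proof eventually_elim
    case (elim d)
    have "keys e \<subseteq> {0..l} \<times> {0..d}" if e: "e \<in> F" for e
    proof
      fix v assume v: "v \<in> keys e"
      then have "snd v \<le> N" using N e by blast
      moreover have "v \<in> {0..l} \<times> UNIV" using F e v by (auto simp: exponents_def)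
      ultimately show "v \<in> {0..l} \<times> {0..d}" using elim by (cases v) auto
    qed
    then have "F \<subseteq> exponents ({0..l} \<times> {0..d}) n" using F by (auto simp: exponents_def)
    moreover have "exponents ({0..l} \<times> {0..d}) n \<subseteq> exponents ({0..l} \<times> UNIV) n"
      by (auto simp: exponents_def)
    ultimately show ?case by (simp add: finite_exponents)
  qed
qed

theorem theorem3p1:
  fixes l n :: nat and k :: int and q :: complex and lam z :: "nat \<Rightarrow> complex"
  assumes "l \<ge> 1" and "q \<noteq> 0" and "norm q < 1"
    and "\<forall>i\<in>{1..l+1}. z i = exp (lam i)"
  shows "whittaker_spec l q z (int n) k = chi l q lam n k \<and>
    character l q lam n k \<longlonglongrightarrow> chi l q lam n k \<and>
    has_trace (V_inf l n) (q_L0 q \<circ> exp_H l k lam) (chi l q lam n k)"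
proof -
  let ?y = "\<lambda>i. exp (lam i)"
  let ?X = "{0..l} \<times> (UNIV :: nat set)"
  define K where "K = (\<Prod>i=1..l+1. ?y i powi k)"
  define w where "w e = K * mon_eval (variable_value q ?y) e" for e
  define t where "t = K * infsum (mon_eval (variable_value q ?y)) (exponents ?X n)"
  have T: "diagonal w (q_L0 q \<circ> exp_H l k lam)"
    using diagonal_torus_action by (simp add: w_def[abs_def] K_def)
  have t: "(w has_sum t) (exponents ?X n)"
    unfolding w_def t_def using summable_variable_value[OF \<open>norm q < 1\<close>]
    by (intro has_sum_cmult_right has_sum_infsum summable_mon_eval)
  have "character l q lam n k = (\<lambda>d. sum w (exponents ({0..l} \<times> {0..d}) n))"
    by (rule ext) (simp add: character_def V_fin_def fin_trace_diagonal[OF T])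
  then have lim: "character l q lam n k \<longlonglongrightarrow> t"
    using filterlim_compose[OF t[unfolded has_sum_def] filterlim_truncated_exponents] by simp
  then have chi: "chi l q lam n k = t"
    by (simp add: chi_def limI)
  have "whittaker_spec l q z (int n) k =
      (\<Prod>r=1..l+1. z r powi k) * fps_nth (\<Prod>j=0..l. qexp_series q (z (j + 1))) n"
    using assms by (intro whittaker_spec_eq) auto
  also have "(\<Prod>r=1..l+1. z r powi k) = K"
    unfolding K_def using assms by (intro prod.cong) auto
  also have "(\<Prod>j=0..l. qexp_series q (z (j + 1))) = (\<Prod>j=0..l. qexp_series q (?y (j + 1)))"
    using assms by (intro prod.cong) auto
  also have "\<dots> = hom_series (variable_value q ?y) ?X"
    by (rule hom_series_eq_prod_qexp[OF \<open>norm q < 1\<close>, symmetric])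
  also have "K * fps_nth (hom_series (variable_value q ?y) ?X) n = t"
    by (simp add: hom_series_def t_def)
  finally show ?thesis
    using lim has_trace_diagonal[OF T t] by (simp add: chi V_inf_def)
qed

end
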